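(* Consider the nonlinear system $\dot x=f(x)+Bu+Ed$ with $x\in\mathbb R^n$, $u\in\mathbb R^m$, $d\in\mathbb R^q$, $E\in\mathbb R^{n\times q}$, and $f(x)=AZ(x)$, where $A\in\mathbb R^{n\times s}$, $B\in\mathbb R^{n\times m}$ and $Z(x)=\begin{bmatrix} x \\ Q(x) \end{bmatrix}$, with $Z:\mathbb R^n\to\mathbb R^s$ continuously differentiable and $Q:\mathbb R^n\to\mathbb R^{s-n}$ containing only nonlinear functions. Assume that the disturbance $d$ is generated by the exosystem $\dot w=\Psi w$, $d=\Gamma w$ described in the context, with $\sigma_1$ known frequencies $\psi_1,\dots,\psi_{\sigma_1}>0$, $\sigma_2$ constant modes, and unknown $\Gamma\in\mathbb R^{q\times(2\sigma_1+\sigma_2)}$. Let $U_0,X_1,Z_0$ be the data matrices and $W\in\mathbb R^{(2\sigma_1+\sigma_2)\times T}$ the known matrix defined in the context. Let $R_Q\in\mathbb R^{n\times\tau}$ be a matrix and $\mathcal X\subseteq\mathbb R^n$ a set such that $\frac{\partial Q}{\partial x}(x)^\top\frac{\partial Q}{\partial x}(x)\preceq R_QR_Q^\top$ for any $x\in\mathcal X$. Consider the following semidefinite program in the decision variables $P\in\mathbb S^{n\times n}$, $Y_1\in\mathbb R^{T\times n}$, $G_2\in\mathbb R^{T\times(s-n)}$, $\alpha\in\mathbb R_{>0}$: $$P\succ0,\qquad Z_0Y_1=\begin{bmatrix} P \\ 0_{(s-n)\times n} \end{bmatrix},$$ $$\begin{bmatrix} X_1Y_1+(X_1Y_1)^\top+\alpha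 I_n & \star & \star \\ G_2^\top X_1^\top & -I_{s-n} & \star \\ R_Q^\top P & 0 & -I_\tau \end{bmatrix}\preceq0,$$ $$Z_0G_2=\begin{bmatrix} 0_{n\times(s-n)} \\ I_{s-n} \end{bmatrix},\qquad 0_{(2\sigma_1+\sigma_2)\times s}=W\begin{bmatrix} Y_1 & G_2 \end{bmatrix}.$$ If the program is feasible, then the control law $u=KZ(x)$ with $K=U_0\begin{bmatrix} Y_1P^{-1} & G_2 \end{bmatrix}$ is such that the closed-loop dynamics $\dot x=(A+BK)Z(x)+Ed$ are exponentially contractive on $\mathcal X$, i.e., there exist $P\in\mathbb S^{n\times n}$, $P\succ0$, and $\beta>0$ such that for all $x\in\mathcal X$ $$\Big((A+BK)\frac{\partial Z(x)}{\partial x}\Big)^\top P^{-1}+P^{-1}(A+BK)\frac{\partial Z(x)}{\partial x}\preceq-\beta P^{-1}.$$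
   Context: $\mathbb S^{n\times n}$ is the set of real symmetric $n\times n$ matrices; $\succ,\succeq,\prec,\preceq$ refer to (semi)definiteness; $\star$ denotes entries determined by symmetry of the block matrix. Exosystem: $d(t)=\Gamma w(t)$ with $\dot w=\Psi w$, $w=[w_1^\top\ \cdots\ w_{\sigma_1}^\top\ w_{\sigma_1+1}\ \cdots\ w_{\sigma_1+\sigma_2}]^\top\in\mathbb R^{2\sigma_1+\sigma_2}$, $w_i\in\mathbb R^2$ for $i\le\sigma_1$ and $w_i\in\mathbb R$ for $i>\sigma_1$, $$\Psi=\mathrm{diag}\Big(\begin{bmatrix} 0 & \psi_1 \\ -\psi_1 & 0 \end{bmatrix},\dots,\begin{bmatrix} 0 & \psi_{\sigma_1} \\ -\psi_{\sigma_1} & 0 \end{bmatrix},\underbrace{0,\dots,0}_{\sigma_2\text{ times}}\Big),$$ and unknown initial condition $w(0)$. Data: for an integer $T>0$ and distinct sampling times $0\le t_0<\dots<t_{T-1}$, samples $x_i=x(t_i)$, $u_i=u(t_i)$, $\dot x_i=\dot x(t_i)$, $d_i=d(t_i)$ satisfying $\dot x_i=AZ(x_i)+Bu_i+Ed_i$ are collected in $U_0=[u_0\ \cdots\ u_{T-1}]$, $X_1=[\dot x_0\ \cdots\ \dot x_{T-1}]$, $Z_0=[Z(x_0)\ \cdots\ Z(x_{T-1})]$, $D_0=[d_0\ \cdots\ d_{T-1}]$, so that $X_1=AZ_0+BU_0+ED_0$ ($D_0$ is unknown). Matrix $W$: $W=[W_1^\top\ \cdots\ W_{\sigma_1+\sigma_2}^\top]^\top$,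 where $$W_i=\begin{bmatrix} \cos(\psi_it_0) & \cdots & \cos(\psi_it_{T-1}) \\ \sin(\psi_it_0) & \cdots & \sin(\psi_it_{T-1}) \end{bmatrix}\ (i=1,\dots,\sigma_1),\qquad W_i=[1\ \cdots\ 1]\in\mathbb R^{1\times T}\ (i=\sigma_1+1,\dots,\sigma_1+\sigma_2).$$ *)

theory Defs
  imports "HOL-Analysis.Analysis"
begin

definition pos_def :: "real^'n^'n \<Rightarrow> bool" where
  "pos_def M \<longleftrightarrow> transpose M = M \<and> (\<forall>v. v \<noteq> 0 \<longrightarrow> 0 < v \<bullet> (M *v v))"

definition pos_semidef :: "real^'n^'n \<Rightarrow> bool" where
  "pos_semidef M \<longleftrightarrow> transpose M = M \<and> (\<forall>v. 0 \<le> v \<bullet> (M *v v))"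

definition loewner_le :: "real^'n^'n \<Rightarrow> real^'n^'n \<Rightarrow> bool" (infix "\<preceq>" 50) where
  "M \<preceq> N \<longleftrightarrow> pos_semidef (N - M)"

text \<open>
  A direct sum of coordinate spaces is indexed by the disjoint sum of the index types; the
  type \<^typ>\<open>'a + 'b\<close> has \<open>CARD('a) + CARD('b)\<close> elements.
\<close>

definition stack_vec :: "'c^'a \<Rightarrow> 'c^'b \<Rightarrow> 'c^('a + 'b)" where
  "stack_vec v w = (\<chi> i. case i of Inl a \<Rightarrow> v $ a | Inr b \<Rightarrow> w $ b)"

definition stack_rows :: "'c^'k^'a \<Rightarrow> 'c^'k^'b \<Rightarrow> 'c^'k^('a + 'b)" where
  "stack_rows M N = (\<chi> i. case i of Inl a \<Rightarrow> M $ a | Inr b \<Rightarrow> N $ b)"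

definition join_cols :: "'c^'a^'k \<Rightarrow> 'c^'b^'k \<Rightarrow> 'c^('a + 'b)^'k" where
  "join_cols M N = (\<chi> i. stack_vec (M $ i) (N $ i))"

text \<open>The lower triangle is given; the blocks above the diagonal are the transposes.\<close>

definition sym_block3 ::
  "real^'a^'a \<Rightarrow>
   real^'a^'b \<Rightarrow> real^'b^'b \<Rightarrow>
   real^'a^'c \<Rightarrow> real^'b^'c \<Rightarrow> real^'c^'c \<Rightarrow>
   real^('a + 'b + 'c)^('a + 'b + 'c)" where
  "sym_block3 M11 M21 M22 M31 M32 M33 =
     stack_rows (join_cols M11 (join_cols (transpose M21) (transpose M31)))
    (stack_rows (join_cols M21 (join_cols M22 (transpose M32)))
                (join_cols M31 (join_cols M32 M33)))"

definition matrix_of_cols :: "('k \<Rightarrow> real^'a) \<Rightarrow> real^'k^'a" where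
  "matrix_of_cols c = (\<chi> i k. c k $ i)"

definition cont_differentiable :: "(real^'n \<Rightarrow> real^'m) \<Rightarrow> bool" where
  "cont_differentiable f \<longleftrightarrow>
     (\<forall>x. f differentiable (at x)) \<and> continuous_on UNIV (\<lambda>x. jacobian f (at x))"

text \<open>
  The numbers \<open>\<sigma>\<^sub>1\<close>, \<open>\<sigma>\<^sub>2\<close> of oscillatory and constant modes may be zero individually, so the
  exosystem state is indexed by one linearly ordered type \<open>'w\<close> with \<open>CARD('w) = 2\<sigma>\<^sub>1 + \<sigma>\<^sub>2\<close>
  rather than by a sum of (necessarily nonempty) types. An index is identified with its
  zero-based position in the order: positions \<open>2k, 2k+1\<close> with \<open>k < \<sigma>\<^sub>1\<close> belong to the oscillator
  with frequency \<open>\<psi> k\<close>, and the last \<open>\<sigma>\<^sub>2\<close> positions to the constant modes.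
\<close>

definition pos :: "'w::{finite,linorder} \<Rightarrow> nat" where
  "pos i = card {..<i}"

definition exo_matrix ::
  "nat \<Rightarrow> (nat \<Rightarrow> real) \<Rightarrow> ((real, 'w::{finite,linorder}) vec, 'w) vec" where
  "exo_matrix \<sigma>1 \<psi> = (\<chi> i j.
     if pos i < 2 * \<sigma>1 \<and> even (pos i) \<and> pos j = pos i + 1 then \<psi> (pos i div 2)
     else if pos j < 2 * \<sigma>1 \<and> even (pos j) \<and> pos i = pos j + 1 then - \<psi> (pos j div 2)
     else 0)"

definition mode_matrix ::
  "nat \<Rightarrow> (nat \<Rightarrow> real) \<Rightarrow> ('k \<Rightarrow> real) \<Rightarrow> ((real, 'k::finite) vec, 'w::{finite,linorder}) vec" where
  "mode_matrix \<sigma>1 \<psi> t = (\<chi> i k.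
     if pos i < 2 * \<sigma>1
     then (if even (pos i) then cos (\<psi> (pos i div 2) * t k) else sin (\<psi> (pos i div 2) * t k))
     else 1)"

end

theory Submission
  imports Defs
begin

text \<open>
  The exosystem is solved explicitly: each component of \<open>w\<close> is a fixed linear combination of the
  modes recorded in \<open>W\<close>, so \<open>W [Y1 G2] = 0\<close> forces \<open>D0 [Y1 G2] = 0\<close> although \<open>D0\<close> is unknown.
  With \<open>Z0 [Y1 P\<inverse> G2] = I\<close> this gives \<open>A + B K = X1 [Y1 P\<inverse> G2]\<close>. The contraction inequality,
  with \<open>S = P\<close>, is then the LMI evaluated at \<open>(p, J P p, R\<^sub>Q\<^sup>T P p)\<close>, where \<open>p = P\<inverse> v\<close> and \<open>J\<close> is the
  Jacobian of \<open>Q\<close>; the bound on \<open>J\<close> absorbs the two quadratic terms that remain.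
\<close>

subsection \<open>Block matrices\<close>

lemma sum_UNIV_Plus:
  fixes f :: "'a::finite + 'b::finite \<Rightarrow> 'c::comm_monoid_add"
  shows "sum f UNIV = (\<Sum>a\<in>UNIV. f (Inl a)) + (\<Sum>b\<in>UNIV. f (Inr b))"
  by (simp flip: UNIV_Plus_UNIV add: sum.Plus)

lemma vec_eq_sum_index_iff:
  fixes v w :: "'c^('a::finite + 'b::finite)"
  shows "v = w \<longleftrightarrow> (\<forall>a. v $ Inl a = w $ Inl a) \<and> (\<forall>b. v $ Inr b = w $ Inr b)"
  by (metis vec_eq_iff sum.exhaust)

lemma stack_vec_nth [simp]:
  "stack_vec v w $ Inl a = v $ a" "stack_vec v w $ Inr b = w $ b"
  by (simp_all add: stack_vec_def)

lemma stack_rows_nth [simp]: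
  "stack_rows M N $ Inl a = M $ a" "stack_rows M N $ Inr b = N $ b"
  by (simp_all add: stack_rows_def)

lemma join_cols_nth [simp]: "join_cols M N $ i = stack_vec (M $ i) (N $ i)"
  by (simp add: join_cols_def)

lemma inner_stack_vec:
  fixes a c :: "real^'a" and b d :: "real^'b"
  shows "stack_vec a b \<bullet> stack_vec c d = a \<bullet> c + b \<bullet> d"
  by (simp add: inner_vec_def sum_UNIV_Plus)

lemma join_cols_mult_stack_vec:
  fixes M :: "real^'a^'k" and N :: "real^'b^'k"
  shows "join_cols M N *v stack_vec v w = M *v v + N *v w"
  by (simp add: vec_eq_iff matrix_vector_mult_def sum_UNIV_Plus)

lemma stack_rows_mult_vec:
  fixes M :: "real^'k^'a" and N :: "real^'k^'b"
  shows "stack_rows M N *v v = stack_vec (M *v v) (N *v v)"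
  by (simp add: vec_eq_sum_index_iff matrix_vector_mult_def)

lemma mult_join_cols:
  fixes M :: "real^'k^'l" and N1 :: "real^'a^'k" and N2 :: "real^'b^'k"
  shows "M ** join_cols N1 N2 = join_cols (M ** N1) (M ** N2)"
proof -
  have "(M ** join_cols N1 N2) $ i = join_cols (M ** N1) (M ** N2) $ i" for i
    unfolding vec_eq_sum_index_iff by (simp add: matrix_matrix_mult_def)
  then show ?thesis by (simp add: vec_eq_iff)
qed

lemma stack_rows_mult:
  fixes M1 :: "real^'k^'a" and M2 :: "real^'k^'b" and N :: "real^'l^'k"
  shows "stack_rows M1 M2 ** N = stack_rows (M1 ** N) (M2 ** N)"
  by (simp add: vec_eq_sum_index_iff matrix_matrix_mult_def)

lemma join_cols_mult_stack_rows:
  fixes M1 :: "real^'a^'k" and M2 :: "real^'b^'k" and N1 :: "real^'l^'a" and N2 :: "real^'l^'b"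
  shows "join_cols M1 M2 ** stack_rows N1 N2 = M1 ** N1 + M2 ** N2"
  by (simp add: vec_eq_iff matrix_matrix_mult_def sum_UNIV_Plus)

lemma join_cols_unit_eq_mat:
  "join_cols (stack_rows (mat 1) 0) (stack_rows 0 (mat 1)) = (mat 1 :: real^('a::finite + 'b::finite)^('a + 'b))"
  by (simp add: vec_eq_sum_index_iff mat_def)

lemma join_cols_eq_0_iff:
  fixes M :: "real^'a^'k" and N :: "real^'b^'k"
  shows "join_cols M N = 0 \<longleftrightarrow> M = 0 \<and> N = 0"
proof -
  have "join_cols M N = 0 \<longleftrightarrow> (\<forall>i. stack_vec (M $ i) (N $ i) = 0)"
    by (simp add: vec_eq_iff)
  also have "\<dots> \<longleftrightarrow> M = 0 \<and> N = 0"
    unfolding vec_eq_sum_index_iff by (auto simp: vec_eq_iff)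
  finally show ?thesis .
qed

lemma matrix_add_rdistrib:
  fixes M N :: "real^'a^'b" and L :: "real^'c^'a"
  shows "(M + N) ** L = M ** L + N ** L"
  by (simp add: vec_eq_iff matrix_matrix_mult_def sum.distrib distrib_right)

lemma inner_transpose_mult_vec:
  fixes M :: "real^'a^'b"
  shows "v \<bullet> (transpose M *v w) = w \<bullet> (M *v v)"
  by (metis dot_lmul_matrix inner_commute transpose_matrix_vector)

text \<open>Each block above the diagonal is the transpose of one below it, so
  \<open>inner_transpose_mult_vec\<close> gives both the same cross term; hence the factors
  2.\<close>

lemma inner_sym_block3_mult:
  "stack_vec a (stack_vec b c) \<bullet>
     (sym_block3 M11 M21 M22 M31 M32 M33 *v stack_vec a (stack_vec b c)) =
   a \<bullet> (M11 *v a) + b \<bullet> (M22 *v b) + c \<bullet> (M33 *v c)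
     + 2 * (b \<bullet> (M21 *v a)) + 2 * (c \<bullet> (M31 *v a)) + 2 * (c \<bullet> (M32 *v b))"
  unfolding sym_block3_def
  by (simp add: stack_rows_mult_vec join_cols_mult_stack_vec inner_stack_vec inner_add_right
      inner_transpose_mult_vec del: transpose_matrix_vector)

section \<open>Semidefinite order, inverses and the Lyapunov inequality\<close>

lemma loewner_leD:
  assumes "M \<preceq> N"
  shows "v \<bullet> (M *v v) \<le> v \<bullet> (N *v v)"
  using assms
  by (simp add: loewner_le_def pos_semidef_def matrix_vector_mult_diff_rdistrib inner_diff_right)

lemma pos_def_invertible:
  assumes "pos_def P"
  shows "invertible P"
proof -
  have "v = 0" if "P *v v = 0" for v
    using assms that unfolding pos_def_def by (metis inner_zero_right less_irrefl)
  then show ?thesis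
    using invertible_left_inverse matrix_left_invertible_ker by blast
qed

lemma matrix_inv_inverse:
  fixes M :: "real^'a^'a"
  assumes "invertible M"
  shows "M ** matrix_inv M = mat 1" and "matrix_inv M ** M = mat 1"
  using someI_ex[OF assms[unfolded invertible_def]] by (auto simp: matrix_inv_def)

text \<open>Transposing \<open>M ** matrix_inv M = mat 1\<close> shows that
  \<open>transpose (matrix_inv M)\<close> is a left inverse of \<open>M\<close>; multiplying by the
  right inverse identifies the two.\<close>

lemma transpose_matrix_inv_symmetric:
  fixes M :: "real^'a^'a"
  assumes "invertible M" and "transpose M = M"
  shows "transpose (matrix_inv M) = matrix_inv M"
proof -
  have "transpose (matrix_inv M) ** M = transpose (M ** matrix_inv M)"
    by (simp add: matrix_transpose_mul assms(2))
  then have "transpose (matrix_inv M) ** M = mat 1"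
    by (simp add: matrix_inv_inverse(1)[OF assms(1)])
  then show ?thesis
    by (metis matrix_inv_inverse(1)[OF assms(1)] matrix_mul_assoc matrix_mul_lid matrix_mul_rid)
qed

lemma uminus_mult_vec:
  fixes M :: "real^'a^'b"
  shows "(- M) *v v = - (M *v v)"
  by (simp add: vec_eq_iff matrix_vector_mult_def sum_negf)

text \<open>For symmetric \<open>N\<close> the two summands are transposes of each other and share
  the quadratic form \<open>(N *v v) \<bullet> (M *v v)\<close>. This reduces the contraction
  condition to a scalar estimate for each \<open>v\<close>.\<close>

lemma lyapunov_loewner_leI:
  fixes M N :: "real^'a^'a"
  assumes "transpose N = N"
    and "\<And>v. 2 * ((N *v v) \<bullet> (M *v v)) \<le> - \<beta> * (v \<bullet> (N *v v))"
  shows "transpose M ** N + N ** M \<preceq> - \<beta> *\<^sub>R N"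
  unfolding loewner_le_def pos_semidef_def
proof (intro conjI allI)
  have "transpose (N ** M) = transpose M ** N" "transpose (transpose M ** N) = N ** M"
    using assms(1) by (simp_all add: matrix_transpose_mul)
  then show "transpose (- \<beta> *\<^sub>R N - (transpose M ** N + N ** M))
      = - \<beta> *\<^sub>R N - (transpose M ** N + N ** M)"
    using assms(1) by (simp add: vec_eq_iff transpose_def)
  fix v
  have "v \<bullet> (N *v (M *v v)) = (M *v v) \<bullet> (N *v v)"
    using inner_transpose_mult_vec[of v N "M *v v"] assms(1) by simp
  then show "0 \<le> v \<bullet> ((- \<beta> *\<^sub>R N - (transpose M ** N + N ** M)) *v v)"
    using assms(2)[of v]
    by (simp add: matrix_vector_mult_diff_rdistrib matrix_vector_mult_add_rdistrib inner_diff_right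
        inner_add_right inner_transpose_mult_vec uminus_mult_vec inner_commute
        del: transpose_matrix_vector
        flip: matrix_vector_mul_assoc scaleR_matrix_vector_assoc)
qed

subsection \<open>Jacobians\<close>

text \<open>Differentiability is assumed for the stacked map only; \<open>Q\<close> inherits it by
  composition with the linear projection \<open>?p\<close>. Stacking is linear too, so the
  derivative can then be taken blockwise.\<close>

lemma jacobian_stack_vec_id:
  fixes Q :: "real^'n \<Rightarrow> real^'r"
  assumes "(\<lambda>x. stack_vec x (Q x)) differentiable (at \<xi>)"
  shows "jacobian (\<lambda>x. stack_vec x (Q x)) (at \<xi>) = stack_rows (mat 1) (jacobian Q (at \<xi>))"
proof -
  let ?p = "\<lambda>z :: real^('n + 'r). \<chi> b. z $ Inr b"
  let ?s = "\<lambda>(a :: real^'n, b :: real^'r). stack_vec a b"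
  have "linear ?p"
    by (auto intro!: linearI simp: vec_eq_iff)
  then have "(\<lambda>x. ?p (stack_vec x (Q x))) differentiable (at \<xi>)"
    by (rule differentiable_compose[OF linear_imp_differentiable assms])
  then have "Q differentiable (at \<xi>)" by simp
  then have Q: "(Q has_derivative frechet_derivative Q (at \<xi>)) (at \<xi>)"
    using frechet_derivative_works by blast
  have "linear ?s"
    by (auto intro!: linearI simp: vec_eq_sum_index_iff)
  then have "bounded_linear ?s" by (rule linear_conv_bounded_linear[THEN iffD1])
  from bounded_linear.has_derivative[OF this has_derivative_Pair[OF has_derivative_ident Q]]
  have "((\<lambda>x. stack_vec x (Q x)) has_derivative (\<lambda>h. stack_vec h (frechet_derivative Q (at \<xi>) h)))
      (at \<xi>)" by simp
  then have "frechet_derivative (\<lambda>x. stack_vec x (Q x)) (at \<xi>)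
      = (\<lambda>h. stack_vec h (frechet_derivative Q (at \<xi>) h))"
    by (metis frechet_derivative_at)
  then show ?thesis
    by (auto simp: jacobian_def matrix_def vec_eq_sum_index_iff)
      (auto simp: vec_eq_iff mat_def axis_def)
qed

subsection \<open>The exosystem\<close>

lemma inj_pos: "inj (pos :: 'w::{finite,linorder} \<Rightarrow> nat)"
proof (rule linorder_injI)
  fix i j :: 'w assume "i < j"
  then have "{..<i} \<subset> {..<j}" by auto
  then show "pos i \<noteq> pos j"
    unfolding pos_def by (metis finite psubset_card_mono less_irrefl)
qed

text \<open>An injection into a finite set of the same cardinality is onto. This is what supplies
  the partner index of an oscillator component.\<close>

lemma range_pos: "range (pos :: 'w::{finite,linorder} \<Rightarrow> nat) = {..<CARD('w)}"
proof (rule card_subset_eq)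
  have "{..<i} \<subset> UNIV" for i :: 'w by auto
  then show "range (pos :: 'w \<Rightarrow> nat) \<subseteq> {..<CARD('w)}"
    unfolding pos_def by (auto intro!: psubset_card_mono)
  show "card (range (pos :: 'w \<Rightarrow> nat)) = card {..<CARD('w)}"
    by (simp add: card_image inj_pos)
qed simp

text \<open>Rotating the state by the angle \<open>\<omega> * \<theta>\<close> undoes the motion:
  the rotated coordinates \<open>?c1\<close> and \<open>?c2\<close> have zero derivative on the
  half-line. Their values at 0 are \<open>a 0\<close> and \<open>b 0\<close>, and rotating back
  gives the formulas.\<close>

lemma oscillator_solution:
  fixes a b :: "real \<Rightarrow> real"
  assumes a: "\<And>\<theta>. \<theta> \<ge> 0 \<Longrightarrow> (a has_real_derivative \<omega> * b \<theta>) (at \<theta> within {0..})"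
    and b: "\<And>\<theta>. \<theta> \<ge> 0 \<Longrightarrow> (b has_real_derivative - \<omega> * a \<theta>) (at \<theta> within {0..})"
    and "\<theta> \<ge> 0"
  shows "a \<theta> = a 0 * cos (\<omega> * \<theta>) + b 0 * sin (\<omega> * \<theta>)"
    and "b \<theta> = b 0 * cos (\<omega> * \<theta>) - a 0 * sin (\<omega> * \<theta>)"
proof -
  let ?c1 = "\<lambda>x. a x * cos (\<omega> * x) - b x * sin (\<omega> * x)"
  let ?c2 = "\<lambda>x. a x * sin (\<omega> * x) + b x * cos (\<omega> * x)"
  have "(?c1 has_real_derivative 0) (at x within {0..})" if "x \<in> {0..}" for x
    using that by (auto intro!: derivative_eq_intros a b simp: algebra_simps)
  then have "\<exists>c. \<forall>x\<in>{0..}. ?c1 x = c"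
    by (intro has_field_derivative_zero_constant) auto
  then have c1: "?c1 \<theta> = a 0" using \<open>\<theta> \<ge> 0\<close> by force
  have "(?c2 has_real_derivative 0) (at x within {0..})" if "x \<in> {0..}" for x
    using that by (auto intro!: derivative_eq_intros a b simp: algebra_simps)
  then have "\<exists>c. \<forall>x\<in>{0..}. ?c2 x = c"
    by (intro has_field_derivative_zero_constant) auto
  then have c2: "?c2 \<theta> = b 0" using \<open>\<theta> \<ge> 0\<close> by force
  have "a \<theta> = a \<theta> * ((sin (\<omega> * \<theta>))\<^sup>2 + (cos (\<omega> * \<theta>))\<^sup>2)" by simp
  also have "\<dots> = ?c1 \<theta> * cos (\<omega> * \<theta>) + ?c2 \<theta> * sin (\<omega> * \<theta>)" by algebra
  finally show "a \<theta> = a 0 * cos (\<omega> * \<theta>) + b 0 * sin (\<omega> * \<theta>)" unfolding c1 c2 .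
  have "b \<theta> = b \<theta> * ((sin (\<omega> * \<theta>))\<^sup>2 + (cos (\<omega> * \<theta>))\<^sup>2)" by simp
  also have "\<dots> = ?c2 \<theta> * cos (\<omega> * \<theta>) - ?c1 \<theta> * sin (\<omega> * \<theta>)" by algebra
  finally show "b \<theta> = b 0 * cos (\<omega> * \<theta>) - a 0 * sin (\<omega> * \<theta>)" unfolding c1 c2 .
qed

lemma exo_matrix_mult_nth:
  fixes v :: "(real, 'w::{finite,linorder}) vec"
  shows "pos i < 2 * \<sigma>1 \<Longrightarrow> even (pos i) \<Longrightarrow> pos j = pos i + 1 \<Longrightarrow>
      (exo_matrix \<sigma>1 \<psi> *v v) $ i = \<psi> (pos i div 2) * v $ j"
    and "pos i < 2 * \<sigma>1 \<Longrightarrow> even (pos i) \<Longrightarrow> pos j = pos i + 1 \<Longrightarrow>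
      (exo_matrix \<sigma>1 \<psi> *v v) $ j = - \<psi> (pos i div 2) * v $ i"
    and "2 * \<sigma>1 \<le> pos i \<Longrightarrow> (exo_matrix \<sigma>1 \<psi> *v v) $ i = 0"
proof -
  assume *: "pos i < 2 * \<sigma>1" "even (pos i)" "pos j = pos i + 1"
  \<comment> \<open>Injectivity of \<open>pos\<close> turns conditions on positions into equality of
    indices. Parity then separates the branches of \<open>exo_matrix\<close>: an even row meets only
    the first, an odd row only the second, so each of the two rows has a single entry that can be
    nonzero.\<close>
  have j: "pos l = pos i + 1 \<longleftrightarrow> l = j" and i: "pos j = pos l + 1 \<longleftrightarrow> l = i" for l
    using *(3) by (metis injD[OF inj_pos], metis injD[OF inj_pos] add_right_cancel)
  have odd: "odd (pos j)" using * by simp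
  have "exo_matrix \<sigma>1 \<psi> $ i $ l = (if l = j then \<psi> (pos i div 2) else 0)" for l
    unfolding exo_matrix_def vec_lambda_beta j using *(1,2) by auto
  then show "(exo_matrix \<sigma>1 \<psi> *v v) $ i = \<psi> (pos i div 2) * v $ j"
    by (simp add: matrix_vector_mult_def if_distrib[of "\<lambda>c. c * _"] cong: if_cong)
  have "exo_matrix \<sigma>1 \<psi> $ j $ l = (if l = i then - \<psi> (pos i div 2) else 0)" for l
    unfolding exo_matrix_def vec_lambda_beta i using *(1,2) odd by auto
  then show "(exo_matrix \<sigma>1 \<psi> *v v) $ j = - \<psi> (pos i div 2) * v $ i"
    by (simp add: matrix_vector_mult_def if_distrib[of "\<lambda>c. c * _"] cong: if_cong)
next
  assume *: "2 * \<sigma>1 \<le> pos i"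
  \<comment> \<open>An even position below \<open>2 * \<sigma>1\<close> is at most
    \<open>2 * \<sigma>1 - 2\<close>, so its successor is still an oscillator position and never a
    constant mode.\<close>
  have "\<not> (pos j < 2 * \<sigma>1 \<and> even (pos j) \<and> pos i = pos j + 1)" for j :: 'w
  proof
    assume "pos j < 2 * \<sigma>1 \<and> even (pos j) \<and> pos i = pos j + 1"
    with * show False by presburger
  qed
  with * have "exo_matrix \<sigma>1 \<psi> $ i $ j = 0" for j
    unfolding exo_matrix_def vec_lambda_beta by (meson not_less)
  then show "(exo_matrix \<sigma>1 \<psi> *v v) $ i = 0"
    by (simp add: matrix_vector_mult_def)
qed

text \<open>The coefficients expressing \<open>w (t k)\<close> through the rows of the mode matrix
  come from the unknown initial state but do not depend on \<open>k\<close>. They can therefore be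
  pulled out of the sum over the samples, leaving sums that vanish by \<open>W\<close>.\<close>

lemma exo_annihilated:
  fixes w :: "real \<Rightarrow> (real, 'w::{finite,linorder}) vec" and t :: "'k::finite \<Rightarrow> real"
    and y :: "real^'k"
  assumes dim: "2 * \<sigma>1 \<le> CARD('w)"
    and exo: "\<And>\<theta>. \<theta> \<ge> 0 \<Longrightarrow>
      (w has_vector_derivative exo_matrix \<sigma>1 \<psi> *v w \<theta>) (at \<theta> within {0..})"
    and t: "\<And>k. t k \<ge> 0"
    and W: "(mode_matrix \<sigma>1 \<psi> t :: (real^'k, 'w) vec) *v y = 0"
  shows "matrix_of_cols (\<lambda>k. w (t k)) *v y = 0"
proof -
  have D: "((\<lambda>s. w s $ i) has_real_derivative (exo_matrix \<sigma>1 \<psi> *v w \<theta>) $ i) (at \<theta> within {0..})"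
    if "\<theta> \<ge> 0" for i \<theta>
    using bounded_linear.has_vector_derivative[OF bounded_linear_vec_nth[of i] exo[OF that]]
    by (simp add: has_real_derivative_iff_has_vector_derivative)
  have W': "(\<Sum>k\<in>UNIV. (mode_matrix \<sigma>1 \<psi> t :: (real^'k, 'w) vec) $ i $ k * y $ k) = 0" for i
    using W by (simp add: vec_eq_iff matrix_vector_mult_def)
  have osc: "(\<Sum>k\<in>UNIV. w (t k) $ i * y $ k) = 0 \<and> (\<Sum>k\<in>UNIV. w (t k) $ j * y $ k) = 0"
    if i: "pos i < 2 * \<sigma>1" "even (pos i)" and j: "pos j = pos i + 1" for i j
  proof -
    let ?\<omega> = "\<psi> (pos i div 2)"
    have "((\<lambda>s. w s $ i) has_real_derivative ?\<omega> * w \<theta> $ j) (at \<theta> within {0..})"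
      "((\<lambda>s. w s $ j) has_real_derivative - ?\<omega> * w \<theta> $ i) (at \<theta> within {0..})"
      if "\<theta> \<ge> 0" for \<theta>
      using D[OF that, of i] D[OF that, of j] exo_matrix_mult_nth(1,2)[OF i j] by metis+
    note sol = oscillator_solution[OF this t]
    have cos0: "(\<Sum>k\<in>UNIV. cos (?\<omega> * t k) * y $ k) = 0"
      using W'[of i] i by (simp add: mode_matrix_def)
    \<comment> \<open>Row \<open>j\<close> is the sine row of the same oscillator, since halving the
      odd position rounds down to the same frequency index.\<close>
    have "pos j < 2 * \<sigma>1" "odd (pos j)" "pos j div 2 = pos i div 2"
      using i j by presburger+
    then have sin0: "(\<Sum>k\<in>UNIV. sin (?\<omega> * t k) * y $ k) = 0"
      using W'[of j] by (simp add: mode_matrix_def)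
    have "(\<Sum>k\<in>UNIV. w (t k) $ i * y $ k) = w 0 $ i * (\<Sum>k\<in>UNIV. cos (?\<omega> * t k) * y $ k)
        + w 0 $ j * (\<Sum>k\<in>UNIV. sin (?\<omega> * t k) * y $ k)"
      by (simp add: sol(1) sum_distrib_left distrib_right sum.distrib mult.assoc)
    moreover have "(\<Sum>k\<in>UNIV. w (t k) $ j * y $ k) = w 0 $ j * (\<Sum>k\<in>UNIV. cos (?\<omega> * t k) * y $ k)
        - w 0 $ i * (\<Sum>k\<in>UNIV. sin (?\<omega> * t k) * y $ k)"
      by (simp add: sol(2) sum_distrib_left left_diff_distrib sum_subtractf mult.assoc)
    ultimately show ?thesis using cos0 sin0 by simp
  qed
  have "(\<Sum>k\<in>UNIV. w (t k) $ i * y $ k) = 0" for i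
  proof (cases "pos i < 2 * \<sigma>1")
    case True
    show ?thesis
    proof (cases "even (pos i)")
      case even: True
      \<comment> \<open>By parity the successor of an even oscillator position stays below
        \<open>2 * \<sigma>1\<close>, so an index with that position exists.\<close>
      then have "pos i + 1 < CARD('w)" using True dim by presburger
      then obtain j :: 'w where "pos j = pos i + 1"
        using range_pos[where 'w = 'w] by (metis lessThan_iff imageE)
      with osc True even show ?thesis by blast
    next
      case odd: False
      \<comment> \<open>An odd position is at least 1, so the truncated subtraction is exact and
        yields the even member of the pair.\<close>
      have "pos i - 1 < CARD('w)" using True dim by linarith
      then obtain j :: 'w where "pos j = pos i - 1"
        using range_pos[where 'w = 'w] by (metis lessThan_iff imageE)
      with odd True have "pos j < 2 * \<sigma>1" "even (pos j)" "pos i = pos j + 1"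
        by (auto elim: oddE)
      with osc show ?thesis by blast
    qed
  next
    case False
    \<comment> \<open>A constant mode: the corresponding row of the mode matrix consists of ones, so
      the entries of \<open>y\<close> sum to zero.\<close>
    have "((\<lambda>s. w s $ i) has_real_derivative 0) (at \<theta> within {0..})" if "\<theta> \<in> {0..}" for \<theta>
      using D[of \<theta> i] that False by (simp add: exo_matrix_mult_nth(3))
    then have "\<exists>c. \<forall>\<theta>\<in>{0..}. w \<theta> $ i = c"
      by (intro has_field_derivative_zero_constant) auto
    then obtain c where "\<And>k. w (t k) $ i = c" using t by auto
    then show ?thesis using W'[of i] False by (simp add: mode_matrix_def flip: sum_distrib_left)
  qed
  then show ?thesis
    by (simp add: vec_eq_iff matrix_vector_mult_def matrix_of_cols_def)
qed

section \<open>Annihilation of the disturbance samples\<close>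

lemma matrix_of_cols_mult: "matrix_of_cols (\<lambda>k. M *v c k) = M ** matrix_of_cols c"
  by (simp add: vec_eq_iff matrix_of_cols_def matrix_vector_mult_def matrix_matrix_mult_def)

lemma matrix_of_cols_add: "matrix_of_cols (\<lambda>k. b k + c k) = matrix_of_cols b + matrix_of_cols c"
  by (simp add: vec_eq_iff matrix_of_cols_def)

lemma disturbance_annihilated:
  fixes w :: "real \<Rightarrow> (real, 'w::{finite,linorder}) vec" and t :: "'k::finite \<Rightarrow> real"
    and Y :: "real^'l^'k"
  assumes "2 * \<sigma>1 \<le> CARD('w)"
    and "\<And>\<theta>. \<theta> \<ge> 0 \<Longrightarrow>
      (w has_vector_derivative exo_matrix \<sigma>1 \<psi> *v w \<theta>) (at \<theta> within {0..})"
    and dist: "\<And>\<theta>. \<theta> \<ge> 0 \<Longrightarrow> d \<theta> = \<Gamma> *v w \<theta>"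
    and t: "\<And>k. t k \<ge> 0"
    and W: "(mode_matrix \<sigma>1 \<psi> t :: (real^'k, 'w) vec) ** Y = 0"
  shows "matrix_of_cols (\<lambda>k. d (t k)) ** Y = 0"
proof -
  \<comment> \<open>The vector statement applies to everything in the range of \<open>Y\<close>,
    which the mode matrix annihilates.\<close>
  have "matrix_of_cols (\<lambda>k. w (t k)) *v (Y *v v) = 0" for v
    using assms(1,2) t by (rule exo_annihilated) (simp_all add: matrix_vector_mul_assoc W)
  then have "matrix_of_cols (\<lambda>k. w (t k)) ** Y = 0"
    by (simp add: matrix_eq matrix_vector_mul_assoc)
  then show ?thesis
    by (simp add: dist t matrix_of_cols_mult flip: matrix_mul_assoc)
qed

subsection \<open>Contractivity\<close>

theorem theorem5:
  fixes Q :: "real^'n \<Rightarrow> real^'r" and Z :: "real^'n \<Rightarrow> real^('n + 'r)"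
    and A :: "real^('n + 'r)^'n" and B :: "real^'m^'n" and E :: "real^'q^'n"
    and \<sigma>1 \<sigma>2 :: nat and \<psi> :: "nat \<Rightarrow> real"
    and \<Gamma> :: "((real, 'w::{finite,linorder}) vec, 'q) vec"
    and w :: "real \<Rightarrow> (real, 'w) vec" and d :: "real \<Rightarrow> real^'q"
    and x :: "real \<Rightarrow> real^'n" and u :: "real \<Rightarrow> real^'m"
    and t :: "'T::{finite,linorder} \<Rightarrow> real" and xdot :: "'T \<Rightarrow> real^'n"
    and U0 :: "((real, 'T) vec, 'm) vec" and X1 :: "((real, 'T) vec, 'n) vec"
    and Z0 :: "((real, 'T) vec, 'n + 'r) vec" and W :: "((real, 'T) vec, 'w) vec"
    and R\<^sub>Q :: "real^'p^'n" and \<X> :: "(real^'n) set"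
    and P :: "real^'n^'n" and Y1 :: "((real, 'n) vec, 'T) vec"
    and G2 :: "((real, 'r) vec, 'T) vec" and \<alpha> :: real
    and K :: "real^('n + 'r)^'m"
  assumes Z_def: "\<And>\<xi>. Z \<xi> = stack_vec \<xi> (Q \<xi>)"
    and Z_C1: "cont_differentiable Z"
    and Q_nonlinear: "\<And>i. \<not> linear (\<lambda>\<xi>. Q \<xi> $ i)"
    \<comment> \<open>exosystem and disturbance\<close>
    and exo_dim: "CARD('w) = 2 * \<sigma>1 + \<sigma>2"
    and freq_pos: "\<And>k. k < \<sigma>1 \<Longrightarrow> \<psi> k > 0"
    and exo: "\<And>\<theta>. \<theta> \<ge> 0 \<Longrightarrow>
      (w has_vector_derivative exo_matrix \<sigma>1 \<psi> *v w \<theta>) (at \<theta> within {0..})"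
    and dist: "\<And>\<theta>. \<theta> \<ge> 0 \<Longrightarrow> d \<theta> = \<Gamma> *v w \<theta>"
    \<comment> \<open>data\<close>
    and times: "strict_mono t" "\<And>k. t k \<ge> 0"
    and deriv_samples: "\<And>k. (x has_vector_derivative xdot k) (at (t k) within {0..})"
    and dynamics: "\<And>k. xdot k = A *v Z (x (t k)) + B *v u (t k) + E *v d (t k)"
    and U0_def: "U0 = matrix_of_cols (\<lambda>k. u (t k))"
    and X1_def: "X1 = matrix_of_cols xdot"
    and Z0_def: "Z0 = matrix_of_cols (\<lambda>k. Z (x (t k)))"
    and W_def: "W = mode_matrix \<sigma>1 \<psi> t"
    \<comment> \<open>bound on the Jacobian of the nonlinearity\<close>
    and R\<^sub>Q: "\<And>\<xi>. \<xi> \<in> \<X> \<Longrightarrow>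
      transpose (jacobian Q (at \<xi>)) ** jacobian Q (at \<xi>) \<preceq> R\<^sub>Q ** transpose R\<^sub>Q"
    \<comment> \<open>feasibility of the semidefinite program\<close>
    and alpha_pos: "\<alpha> > 0"
    and P_pos: "pos_def P"
    and Z0_Y1: "Z0 ** Y1 = stack_rows P 0"
    and LMI: "sym_block3
        (X1 ** Y1 + transpose (X1 ** Y1) + \<alpha> *\<^sub>R mat 1)
        (transpose G2 ** transpose X1)   (- mat 1)
        (transpose R\<^sub>Q ** P)              0           (- mat 1)
      \<preceq> 0"
    and Z0_G2: "Z0 ** G2 = stack_rows 0 (mat 1)"
    and W_ann: "W ** join_cols Y1 G2 = 0"
    \<comment> \<open>controller gain\<close>
    and K_def: "K = U0 ** join_cols (Y1 ** matrix_inv P) G2"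
  shows "\<exists>(S::real^'n^'n) \<beta>. pos_def S \<and> \<beta> > 0 \<and>
    (\<forall>\<xi>\<in>\<X>.
      transpose ((A + B ** K) ** jacobian Z (at \<xi>)) ** matrix_inv S
        + matrix_inv S ** ((A + B ** K) ** jacobian Z (at \<xi>))
      \<preceq> - \<beta> *\<^sub>R matrix_inv S)"
proof -
  let ?N = "matrix_inv P" and ?C = "A + B ** K"
  have sym: "transpose P = P" using P_pos by (simp add: pos_def_def)
  have inv: "invertible P" using P_pos by (rule pos_def_invertible)
  have PN: "P ** ?N = mat 1" using inv by (rule matrix_inv_inverse)
  let ?G = "join_cols (Y1 ** ?N) G2" and ?D0 = "matrix_of_cols (\<lambda>k. d (t k))"
  have "?D0 ** join_cols Y1 G2 = 0"
    using exo_dim by (intro disturbance_annihilated[OF _ exo dist times(2) W_ann[unfolded W_def]]) auto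
  \<comment> \<open>Both blocks vanish separately, and multiplying the first on the right by
    \<open>?N\<close> keeps it zero.\<close>
  then have "?D0 ** ?G = 0"
    by (simp add: mult_join_cols join_cols_eq_0_iff matrix_mul_assoc)
  moreover have "Z0 ** ?G = mat 1"
    by (simp add: mult_join_cols matrix_mul_assoc Z0_Y1 Z0_G2 stack_rows_mult PN
        join_cols_unit_eq_mat)
  moreover have "X1 = A ** Z0 + B ** U0 + E ** ?D0"
    unfolding X1_def Z0_def U0_def dynamics
    by (simp add: matrix_of_cols_add matrix_of_cols_mult)
  \<comment> \<open>Multiplying the data equation by \<open>?G\<close> replaces \<open>Z0\<close> by
    the identity and \<open>U0\<close> by \<open>K\<close>, and removes the unknown
    \<open>?D0\<close>.\<close>
  ultimately have "X1 ** ?G = ?C"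
    by (simp add: matrix_add_rdistrib K_def flip: matrix_mul_assoc)
  then have C: "?C = join_cols (X1 ** Y1 ** ?N) (X1 ** G2)"
    by (simp add: mult_join_cols matrix_mul_assoc)

  define c where "c = onorm ((*v) P)"
  have "c \<ge> 0" unfolding c_def by (intro onorm_pos_le) simp
  have P_le: "p \<bullet> (P *v p) \<le> (c + 1) * (p \<bullet> p)" for p
  proof -
    have "norm (P *v p) \<le> c * norm p"
      unfolding c_def by (rule onorm) simp
    then have "p \<bullet> (P *v p) \<le> norm p * (c * norm p)"
      by (meson norm_cauchy_schwarz mult_left_mono norm_ge_zero order_trans)
    then show ?thesis
      by (simp add: dot_square_norm algebra_simps power2_eq_square)
         (smt (verit) mult_nonneg_nonneg norm_ge_zero)
  qed
  \<comment> \<open>Chosen so that \<open>\<beta> * (c + 1) = \<alpha>\<close>: by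
    \<open>P_le\<close>, the margin \<open>\<alpha> * (p \<bullet> p)\<close> of the LMI dominates
    \<open>\<beta> * (p \<bullet> (P *v p))\<close>. The summand 1 keeps the denominator positive
    when only \<open>c \<ge> 0\<close> is known.\<close>
  define \<beta> where "\<beta> = \<alpha> / (c + 1)"
  have "\<beta> > 0" using alpha_pos \<open>c \<ge> 0\<close> by (simp add: \<beta>_def)
  have "transpose (?C ** jacobian Z (at \<xi>)) ** ?N + ?N ** (?C ** jacobian Z (at \<xi>)) \<preceq> - \<beta> *\<^sub>R ?N"
    if "\<xi> \<in> \<X>" for \<xi>
  proof (rule lyapunov_loewner_leI)
    show "transpose ?N = ?N" using inv sym by (rule transpose_matrix_inv_symmetric)
    fix v
    \<comment> \<open>In this variable \<open>v \<bullet> (?N *v v)\<close> becomes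
      \<open>p \<bullet> (P *v p)\<close>, and the block \<open>Y1 ** ?N\<close> acting on
      \<open>v\<close> becomes \<open>Y1\<close> acting on \<open>p\<close>.\<close>
    define p where "p = ?N *v v"
    have v: "v = P *v p" by (simp add: p_def matrix_vector_mul_assoc PN)
    let ?J = "jacobian Q (at \<xi>)"
    define b r where "b = ?J *v v" and "r = transpose R\<^sub>Q *v v"
    have "Z = (\<lambda>x. stack_vec x (Q x))" using Z_def by blast
    then have "jacobian Z (at \<xi>) = stack_rows (mat 1) ?J"
      using Z_C1 jacobian_stack_vec_id[of Q \<xi>] by (simp add: cont_differentiable_def)
    then have Mv: "(?C ** jacobian Z (at \<xi>)) *v v = (X1 ** Y1) *v p + (X1 ** G2) *v b"
      by (simp add: C join_cols_mult_stack_rows matrix_vector_mult_add_rdistrib b_def p_def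
          matrix_vector_mul_assoc)
    have "b \<bullet> b \<le> r \<bullet> r"
      using loewner_leD[OF R\<^sub>Q[OF that], of v] inner_transpose_mult_vec[of v "transpose R\<^sub>Q" r]
      by (simp add: b_def r_def inner_transpose_mult_vec del: transpose_matrix_vector
          flip: matrix_vector_mul_assoc)
    moreover have "2 * (p \<bullet> ((X1 ** Y1) *v p)) + \<alpha> * (p \<bullet> p) - b \<bullet> b - r \<bullet> r
        + 2 * (p \<bullet> ((X1 ** G2) *v b)) + 2 * (r \<bullet> r) \<le> 0"
      using loewner_leD[OF LMI, of "stack_vec p (stack_vec b r)"]
      unfolding inner_sym_block3_mult
      by (simp add: matrix_vector_mult_add_rdistrib inner_add_right inner_transpose_mult_vec
          uminus_mult_vec v r_def
          del: transpose_matrix_vector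
          flip: matrix_vector_mul_assoc scaleR_matrix_vector_assoc matrix_transpose_mul)
    ultimately have "2 * (p \<bullet> ((?C ** jacobian Z (at \<xi>)) *v v)) \<le> - (\<alpha> * (p \<bullet> p))"
      by (simp add: Mv inner_add_right distrib_left)
    also have "\<dots> \<le> - (\<beta> * (p \<bullet> (P *v p)))"
      using mult_left_mono[OF P_le[of p], of \<beta>] \<open>\<beta> > 0\<close> \<open>c \<ge> 0\<close> by (simp add: \<beta>_def)
    finally show "2 * ((?N *v v) \<bullet> ((?C ** jacobian Z (at \<xi>)) *v v)) \<le> - \<beta> * (v \<bullet> (?N *v v))"
      unfolding p_def[symmetric] by (simp add: v inner_commute)
  qed
  with P_pos \<open>\<beta> > 0\<close> show ?thesis by blast
qed

end
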